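(* Let $k\in(0,1)$, $k'=\sqrt{1-k^2}$ and $\lambda=\frac{ik}{k'}$ (so that $|\lambda|=k/\sqrt{1-k^2}\in(0,\infty)$). Then $\mathrm{sd}(z;k)=\frac{1}{k'}\mathrm{sn}(k'z;\lambda)$, $\mathrm{cd}(z;k)=\mathrm{cn}(k'z;\lambda)$ and $\mathrm{nd}(z;k)=\mathrm{dn}(k'z;\lambda)$. Consequently, putting $u=k'z$ and writing $\mathrm{sn},\mathrm{cn},\mathrm{dn}$ for the Jacobi elliptic functions $\mathrm{sn}(u;\lambda),\mathrm{cn}(u;\lambda),\mathrm{dn}(u;\lambda)$ of modulus $\lambda$, all four normalized Cayley-Klein algebras with non-vanishing curvatures are realized, with respect to the Lie bracket of meromorphic vector fields in the variable $u$, as follows: (1) $(J,P_1,P_2)=\left(-k'\,\mathrm{dn}\frac{d}{du},\ ik'\,\mathrm{cn}\frac{d}{du},\ i\,\mathrm{sn}\frac{d}{du}\right)$ satisfies the elliptic Cayley-Klein relations; (2) $(J,P_1,P_2)=\left(k'\,\mathrm{dn}\frac{d}{du},\ \mathrm{sn}\frac{d}{du},\ k'\,\mathrm{cn}\frac{d}{du}\right)$ satisfies the hyperbolic Cayley-Klein relations; (3) $(J,P_1,P_2)=\left(ik'\,\mathrm{dn}\frac{d}{du},\ i\,\mathrm{sn}\frac{d}{du},\ -k'\,\mathrm{cn}\frac{d}{du}\right)$ satisfies the co-hyperbolic Cayley-Klein relations; (4) $(J,P_1,P_2)=\left(\mathrm{sn}\frac{d}{du},\ -k'\,\mathrm{dn}\frac{d}{du},\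 k'\,\mathrm{cn}\frac{d}{du}\right)$ satisfies the doubly hyperbolic Cayley-Klein relations.
   Context: For meromorphic functions $f,g$ of one complex variable $u$, the Lie bracket of vector fields is $\left[f\frac{d}{du},g\frac{d}{du}\right]=\left(f\frac{dg}{du}-g\frac{df}{du}\right)\frac{d}{du}$. The normalized 2-D Cayley-Klein relations with non-vanishing curvatures for a triple $(J,P_1,P_2)$ are: - elliptic: $[J,P_1]=P_2$, $[J,P_2]=-P_1$, $[P_1,P_2]=J$; - hyperbolic (Lobachevski): $[J,P_1]=P_2$, $[J,P_2]=-P_1$, $[P_1,P_2]=-J$; - co-hyperbolic (anti-de Sitter): $[J,P_1]=P_2$, $[J,P_2]=P_1$, $[P_1,P_2]=J$; - doubly hyperbolic (de Sitter): $[J,P_1]=P_2$, $[J,P_2]=P_1$, $[P_1,P_2]=-J$. For a complex modulus $\lambda$ the Jacobi elliptic functions are the meromorphic functions on $\mathbb{C}$ determined by $\mathrm{sn}'=\mathrm{cn}\,\mathrm{dn}$, $\mathrm{cn}'=-\mathrm{sn}\,\mathrm{dn}$, $\mathrm{dn}'=-\lambda^2\,\mathrm{sn}\,\mathrm{cn}$ with $\mathrm{sn}(0)=0$, $\mathrm{cn}(0)=\mathrm{dn}(0)=1$. Further, $\mathrm{sd}=\mathrm{sn}/\mathrm{dn}$, $\mathrm{cd}=\mathrm{cn}/\mathrm{dn}$, $\mathrm{nd}=1/\mathrm{dn}$. The realizations in terms of $\mathrm{nd},\mathrm{cd},\mathrm{sd}$ of modulus $k$ in the variable $z$ from which (1)-(4)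 are obtained by substitution are, for $(J,P_1,P_2)$: elliptic $\left(-\mathrm{nd},\,i\,\mathrm{cd},\,i\,\mathrm{sd}\right)\frac{d}{dz}$; hyperbolic $\left(\mathrm{nd},\,\mathrm{sd},\,\mathrm{cd}\right)\frac{d}{dz}$; co-hyperbolic $\left(i\,\mathrm{nd},\,i\,\mathrm{sd},\,-\mathrm{cd}\right)\frac{d}{dz}$; doubly hyperbolic $\left(\mathrm{sd},\,-\mathrm{nd},\,\mathrm{cd}\right)\frac{d}{dz}$.
   Formalization: In (4), P_1 and P_2 are exchanged: the triple (sn, k' cn, -k' dn) d/du is proved doubly hyperbolic, because the printed triple (sn, -k' dn, k' cn) has [P_1,P_2]=J and so satisfies the co-hyperbolic relations instead. *)

theory Defs
  imports "HOL-Complex_Analysis.Complex_Analysis"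
begin

text \<open>
  Meromorphic functions on the plane are represented by their normalised representatives
  (\<open>nicely_meromorphic_on UNIV\<close>): removable singularities are filled in and the value at a pole
  is 0. Two such functions agree as meromorphic functions iff they are equal as HOL functions.
\<close>

definition is_jacobi_triple ::
  "complex \<Rightarrow> (complex \<Rightarrow> complex) \<times> (complex \<Rightarrow> complex) \<times> (complex \<Rightarrow> complex) \<Rightarrow> bool" where
  "is_jacobi_triple m = (\<lambda>(sn, cn, dn).
     sn nicely_meromorphic_on UNIV \<and> cn nicely_meromorphic_on UNIV \<and>
     dn nicely_meromorphic_on UNIV \<and>
     sn analytic_on {0} \<and> cn analytic_on {0} \<and> dn analytic_on {0} \<and>
     sn 0 = 0 \<and> cn 0 = 1 \<and> dn 0 = 1 \<and>
     (\<forall>u. sn analytic_on {u} \<and> cn analytic_on {u} \<and> dn analytic_on {u} \<longrightarrow>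
        (sn has_field_derivative cn u * dn u) (at u) \<and>
        (cn has_field_derivative - (sn u * dn u)) (at u) \<and>
        (dn has_field_derivative - (m\<^sup>2 * sn u * cn u)) (at u)))"

text \<open>The parameter is the modulus, so that \<open>dn' = - m\<^sup>2 sn cn\<close>, not the parameter \<open>m\<^sup>2\<close>.\<close>

definition jacobi_triple ::
  "complex \<Rightarrow> (complex \<Rightarrow> complex) \<times> (complex \<Rightarrow> complex) \<times> (complex \<Rightarrow> complex)" where
  "jacobi_triple m = (THE t. is_jacobi_triple m t)"

definition jacobi_sn :: "complex \<Rightarrow> complex \<Rightarrow> complex" where
  "jacobi_sn m = fst (jacobi_triple m)"

definition jacobi_cn :: "complex \<Rightarrow> complex \<Rightarrow> complex" where
  "jacobi_cn m = fst (snd (jacobi_triple m))"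

definition jacobi_dn :: "complex \<Rightarrow> complex \<Rightarrow> complex" where
  "jacobi_dn m = snd (snd (jacobi_triple m))"

text \<open>
  Quotients are taken in the field of meromorphic functions: \<open>remove_sings\<close> supplies the limit
  at common poles of numerator and denominator, where the pointwise quotient is \<open>0 / 0 = 0\<close>.
\<close>

definition jacobi_sd :: "complex \<Rightarrow> complex \<Rightarrow> complex" where
  "jacobi_sd m = remove_sings (\<lambda>z. jacobi_sn m z / jacobi_dn m z)"

definition jacobi_cd :: "complex \<Rightarrow> complex \<Rightarrow> complex" where
  "jacobi_cd m = remove_sings (\<lambda>z. jacobi_cn m z / jacobi_dn m z)"

definition jacobi_nd :: "complex \<Rightarrow> complex \<Rightarrow> complex" where
  "jacobi_nd m = remove_sings (\<lambda>z. 1 / jacobi_dn m z)"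

text \<open>
  The vector field \<open>f d/du\<close> is represented by its coefficient \<open>f\<close>. In the bracket
  \<open>remove_sings\<close> again passes to the normalised representative, since \<open>deriv\<close> is unspecified
  at poles.
\<close>

definition meromorphic_vector_field :: "(complex \<Rightarrow> complex) \<Rightarrow> bool" where
  "meromorphic_vector_field f \<longleftrightarrow> f nicely_meromorphic_on UNIV"

definition lie_bracket :: "(complex \<Rightarrow> complex) \<Rightarrow> (complex \<Rightarrow> complex) \<Rightarrow> complex \<Rightarrow> complex" where
  "lie_bracket f g = remove_sings (\<lambda>u. f u * deriv g u - g u * deriv f u)"

definition elliptic_CK ::
  "(complex \<Rightarrow> complex) \<Rightarrow> (complex \<Rightarrow> complex) \<Rightarrow> (complex \<Rightarrow> complex) \<Rightarrow> bool" where
  "elliptic_CK J P1 P2 \<longleftrightarrow>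
     meromorphic_vector_field J \<and> meromorphic_vector_field P1 \<and> meromorphic_vector_field P2 \<and>
     lie_bracket J P1 = P2 \<and> lie_bracket J P2 = (\<lambda>u. - P1 u) \<and> lie_bracket P1 P2 = J"

definition hyperbolic_CK ::
  "(complex \<Rightarrow> complex) \<Rightarrow> (complex \<Rightarrow> complex) \<Rightarrow> (complex \<Rightarrow> complex) \<Rightarrow> bool" where
  "hyperbolic_CK J P1 P2 \<longleftrightarrow>
     meromorphic_vector_field J \<and> meromorphic_vector_field P1 \<and> meromorphic_vector_field P2 \<and>
     lie_bracket J P1 = P2 \<and> lie_bracket J P2 = (\<lambda>u. - P1 u) \<and> lie_bracket P1 P2 = (\<lambda>u. - J u)"

definition co_hyperbolic_CK ::
  "(complex \<Rightarrow> complex) \<Rightarrow> (complex \<Rightarrow> complex) \<Rightarrow> (complex \<Rightarrow> complex) \<Rightarrow> bool" where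
  "co_hyperbolic_CK J P1 P2 \<longleftrightarrow>
     meromorphic_vector_field J \<and> meromorphic_vector_field P1 \<and> meromorphic_vector_field P2 \<and>
     lie_bracket J P1 = P2 \<and> lie_bracket J P2 = P1 \<and> lie_bracket P1 P2 = J"

definition doubly_hyperbolic_CK ::
  "(complex \<Rightarrow> complex) \<Rightarrow> (complex \<Rightarrow> complex) \<Rightarrow> (complex \<Rightarrow> complex) \<Rightarrow> bool" where
  "doubly_hyperbolic_CK J P1 P2 \<longleftrightarrow>
     meromorphic_vector_field J \<and> meromorphic_vector_field P1 \<and> meromorphic_vector_field P2 \<and>
     lie_bracket J P1 = P2 \<and> lie_bracket J P2 = P1 \<and> lie_bracket P1 P2 = (\<lambda>u. - J u)"

text \<open>
  The order of \<open>P1\<close> and \<open>P2\<close> matters for the doubly hyperbolic relations: exchanging them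
  changes only the sign in the third relation. With \<open>J = sn\<close> the realization is
  \<open>P1 = k' cn\<close>, \<open>P2 = - k' dn\<close>; the opposite labelling, which is the printed one, has
  \<open>[P1, P2] = J\<close> and so satisfies the co-hyperbolic relations instead.
\<close>

end

theory Submission
  imports Defs
begin

text \<open>
  Existence of the Jacobi functions for an arbitrary modulus needs no theta functions. Inverting
  the elliptic integral near 0 gives a local solution of the differential equations; the duplication
  formulas, applied at \<open>u / 2\<close>, turn a meromorphic solution on a disc of radius \<open>r\<close> into one on the
  disc of radius \<open>2 r\<close>; and solutions on growing discs agree, because the differential equations
  determine all Taylor coefficients at 0. The same uniqueness gives the modular transformation:
  the quotients \<open>a sd\<close>, \<open>cd\<close>, \<open>nd\<close> at \<open>u / a\<close> solve the equations of the new modulus \<open>l\<close> when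
  \<open>a\<^sup>2 = 1 - m\<^sup>2\<close> and \<open>(l a)\<^sup>2 = - m\<^sup>2\<close>. The commutation relations are then
  the derivative formulas combined with the two quadratic relations between sn, cn and dn.
\<close>

subsection \<open>Identities off a discrete set\<close>

text \<open>Identity theorem in the form used throughout. On a connected open set a meromorphic
  function either equals \<open>c\<close> off a discrete set or avoids \<open>c\<close> off a
  discrete set, and its behaviour near \<open>a\<close> excludes the second case.\<close>

lemma cosparse_eq_meromorphicI:
  assumes "f meromorphic_on U" "open U" "connected U" "a \<in> U"
    and "\<forall>\<^sub>F z in at a. f z = c"
  shows "\<forall>\<^sub>\<approx>z\<in>U. f z = c"
proof -
  have "\<not> (\<forall>\<^sub>\<approx>z\<in>U. f z \<noteq> c)"
  proof
    assume "\<forall>\<^sub>\<approx>z\<in>U. f z \<noteq> c"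
    then have "\<forall>\<^sub>F z in at a. f z \<noteq> c"
      using assms by (simp add: eventually_cosparse_open_eq)
    with assms(5) have "\<forall>\<^sub>F z in at a. False"
      by eventually_elim simp
    then show False by simp
  qed
  then show ?thesis
    using meromorphic_imp_constant_or_avoid[OF assms(1-3), of c] by blast
qed

text \<open>The other side of the same dichotomy, used to see that a denominator which is 1 at the
  origin vanishes only on a discrete set.\<close>

lemma cosparse_neq_meromorphicI:
  assumes "f meromorphic_on U" "open U" "connected U" "a \<in> U"
    and "isCont f a" "f a \<noteq> c"
  shows "\<forall>\<^sub>\<approx>z\<in>U. f z \<noteq> c"
proof -
  have "\<not> (\<forall>\<^sub>\<approx>z\<in>U. f z = c)"
  proof
    assume "\<forall>\<^sub>\<approx>z\<in>U. f z = c"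
    then have "\<forall>\<^sub>F z in at a. f z = c"
      using assms by (simp add: eventually_cosparse_open_eq)
    moreover have "\<forall>\<^sub>F z in at a. f z \<noteq> c"
      using assms(5,6) tendsto_imp_eventually_ne unfolding isCont_def by blast
    ultimately have "\<forall>\<^sub>F z in at a. False"
      by eventually_elim simp
    then show False by simp
  qed
  then show ?thesis
    using meromorphic_imp_constant_or_avoid[OF assms(1-3), of c] by blast
qed

lemma filterlim_mult_at:
  fixes a :: "'a :: real_normed_field"
  assumes "a \<noteq> 0"
  shows "filterlim (\<lambda>u. a * u) (at (a * z)) (at z)"
proof -
  have "((\<lambda>u. a * u) \<longlongrightarrow> a * z) (at z)"
    by (intro tendsto_intros)
  moreover have "\<forall>\<^sub>F u in at z. a * u \<noteq> a * z"
    using assms by (auto simp: eventually_at_filter)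
  ultimately show ?thesis
    by (simp add: filterlim_at)
qed

text \<open>On an open set, holding off a discrete set means holding in a punctured neighbourhood of
  every point, and a dilation carries punctured neighbourhoods to punctured neighbourhoods.\<close>

lemma cosparse_scale:
  fixes a :: "'a :: real_normed_field"
  assumes "\<forall>\<^sub>\<approx>v\<in>U. P v" "open U" "open V" "a \<noteq> 0" "\<And>u. u \<in> V \<Longrightarrow> a * u \<in> U"
  shows "\<forall>\<^sub>\<approx>u\<in>V. P (a * u)"
proof -
  have "\<forall>\<^sub>F u in at u0. P (a * u)" if "u0 \<in> V" for u0
  proof -
    have "\<forall>\<^sub>F v in at (a * u0). P v"
      using assms that by (simp add: eventually_cosparse_open_eq)
    then show ?thesis
      using filterlim_mult_at[OF \<open>a \<noteq> 0\<close>] by (rule eventually_compose_filterlim)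
  qed
  then show ?thesis
    using assms by (simp add: eventually_cosparse_open_eq)
qed

text \<open>At a pole both sides take the default value 0; at every other point the value is already
  the limit.\<close>

lemma remove_sings_nicely_meromorphic_eq:
  assumes "f nicely_meromorphic_on UNIV"
  shows "remove_sings f = f"
proof
  fix z
  have "(is_pole f z \<and> f z = 0) \<or> f \<midarrow>z\<rightarrow> f z"
    using assms by (auto simp: nicely_meromorphic_on_def)
  then show "remove_sings f z = f z"
    by auto
qed

text \<open>\<open>remove_sings\<close> sees only punctured neighbourhoods, so agreement off a
  discrete set becomes equality everywhere once the right-hand side is normalised.\<close>

lemma remove_sings_eq_of_cosparse_eq:
  assumes "\<forall>\<^sub>\<approx>z\<in>UNIV. f z = g z" "g nicely_meromorphic_on UNIV"
  shows "remove_sings f = g"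
proof -
  have "remove_sings f z = remove_sings g z" for z
    using assms(1) by (intro remove_sings_cong) (auto simp: eventually_cosparse_open_eq)
  then show ?thesis
    using remove_sings_nicely_meromorphic_eq[OF assms(2)] by auto
qed

text \<open>The dilation has an inverse dilation, so it maps the filter \<open>at z\<close> exactly
  onto \<open>at (a * z)\<close>.\<close>

lemma remove_sings_scale:
  assumes "a \<noteq> 0"
  shows "remove_sings (\<lambda>z. f (a * z)) z = remove_sings f (a * z)"
proof -
  have "filterlim (\<lambda>u. inverse a * u) (at z) (at (a * z))"
    using filterlim_mult_at[of "inverse a" "a * z"] assms by (simp flip: mult.assoc)
  then have "filtermap (\<lambda>z. a * z) (at z) = at (a * z)"
    by (rule filtermap_fun_inverse) (use assms in \<open>auto intro: filterlim_mult_at\<close>)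
  then show ?thesis
    using remove_sings_compose[of "\<lambda>z. a * z" z "a * z" f] by (simp add: o_def)
qed

subsection \<open>Uniqueness of solutions\<close>

text \<open>
  Unlike \<open>is_jacobi_triple\<close> this fixes no values at singularities and asks for the equations only off
  a discrete set, so it is preserved by pointwise quotients.
\<close>

definition jacobi_sol ::
  "complex \<Rightarrow> complex set \<Rightarrow> (complex \<Rightarrow> complex) \<Rightarrow> (complex \<Rightarrow> complex) \<Rightarrow> (complex \<Rightarrow> complex) \<Rightarrow> bool" where
  "jacobi_sol m U s c d \<longleftrightarrow>
     s meromorphic_on U \<and> c meromorphic_on U \<and> d meromorphic_on U \<and>
     s analytic_on {0} \<and> c analytic_on {0} \<and> d analytic_on {0} \<and>
     s 0 = 0 \<and> c 0 = 1 \<and> d 0 = 1 \<and>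
     (\<forall>\<^sub>\<approx>u\<in>U. (s has_field_derivative c u * d u) (at u) \<and>
        (c has_field_derivative - (s u * d u)) (at u) \<and>
        (d has_field_derivative - (m\<^sup>2 * s u * c u)) (at u))"

text \<open>Fills in the one point that a punctured neighbourhood leaves out: \<open>deriv f\<close>
  and \<open>g\<close> are continuous at \<open>z\<close>, so their agreement around
  \<open>z\<close> extends to \<open>z\<close>.\<close>

lemma analytic_deriv_eq:
  assumes "f analytic_on {z}" "g analytic_on {z}"
    and ev: "\<forall>\<^sub>F u in at z. (f has_field_derivative g u) (at u)"
  shows "\<forall>\<^sub>F u in nhds z. (f has_field_derivative g u) (at u)"
proof -
  have "deriv f \<midarrow>z\<rightarrow> deriv f z" "g \<midarrow>z\<rightarrow> g z"
    using assms by (auto intro!: isContD analytic_at_imp_isCont analytic_deriv)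
  moreover have "\<forall>\<^sub>F u in at z. deriv f u = g u"
    using ev by eventually_elim (rule DERIV_imp_deriv)
  ultimately have "deriv f \<midarrow>z\<rightarrow> g z"
    by (simp add: tendsto_cong)
  then have "deriv f z = g z"
    using \<open>deriv f \<midarrow>z\<rightarrow> deriv f z\<close> LIM_unique by blast
  then have "(f has_field_derivative g z) (at z)"
    using assms(1) analytic_on_imp_differentiable_at field_differentiable_derivI by fastforce
  then show ?thesis
    using ev by (auto simp: eventually_nhds_conv_at)
qed

text \<open>The discrete exceptional set in \<open>jacobi_sol\<close> may contain 0; analyticity at
  0 recovers the equations there.\<close>

lemma jacobi_sol_near_0:
  assumes "jacobi_sol m U s c d" "open U" "0 \<in> U"
  shows "\<forall>\<^sub>F u in nhds 0. (s has_field_derivative c u * d u) (at u)"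
    and "\<forall>\<^sub>F u in nhds 0. (c has_field_derivative - (s u * d u)) (at u)"
    and "\<forall>\<^sub>F u in nhds 0. (d has_field_derivative - (m\<^sup>2 * s u * c u)) (at u)"
proof -
  have an: "s analytic_on {0}" "c analytic_on {0}" "d analytic_on {0}"
    using assms by (auto simp: jacobi_sol_def)
  have "\<forall>\<^sub>F u in at 0. (s has_field_derivative c u * d u) (at u) \<and>
        (c has_field_derivative - (s u * d u)) (at u) \<and>
        (d has_field_derivative - (m\<^sup>2 * s u * c u)) (at u)"
    using assms by (auto simp: jacobi_sol_def eventually_cosparse_open_eq)
  then have "\<forall>\<^sub>F u in at 0. (s has_field_derivative c u * d u) (at u)"
    "\<forall>\<^sub>F u in at 0. (c has_field_derivative - (s u * d u)) (at u)"
    "\<forall>\<^sub>F u in at 0. (d has_field_derivative - (m\<^sup>2 * s u * c u)) (at u)"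
    by (auto elim: eventually_mono)
  then show "\<forall>\<^sub>F u in nhds 0. (s has_field_derivative c u * d u) (at u)"
    "\<forall>\<^sub>F u in nhds 0. (c has_field_derivative - (s u * d u)) (at u)"
    "\<forall>\<^sub>F u in nhds 0. (d has_field_derivative - (m\<^sup>2 * s u * c u)) (at u)"
    using an by (auto intro!: analytic_deriv_eq analytic_intros)
qed

lemma eventually_const_of_deriv_0:
  fixes f :: "complex \<Rightarrow> complex"
  assumes "\<forall>\<^sub>F u in nhds a. (f has_field_derivative 0) (at u)"
  shows "\<forall>\<^sub>F u in nhds a. f u = f a"
proof -
  obtain e where e: "e > 0" "\<And>u. dist u a < e \<Longrightarrow> (f has_field_derivative 0) (at u)"
    using assms by (auto simp: eventually_nhds_metric)
  have "\<exists>c. \<forall>u\<in>ball a e. f u = c"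
    using e(2) by (intro has_field_derivative_zero_constant)
      (auto simp: dist_commute intro: has_field_derivative_at_within)
  then have const: "f u = f a" if "u \<in> ball a e" for u
    using that e(1) by (metis centre_in_ball)
  have "\<forall>\<^sub>F u in nhds a. u \<in> ball a e"
    using e(1) by (intro eventually_nhds_in_open) auto
  then show ?thesis
    by eventually_elim (rule const)
qed

text \<open>Both expressions have derivative 0 near the origin and value 1 at it. The identity
  theorem then carries the relations across the poles to all of \<open>U\<close>.\<close>

lemma jacobi_sol_squares:
  assumes "jacobi_sol m U s c d" "open U" "connected U" "0 \<in> U"
  shows "\<forall>\<^sub>\<approx>u\<in>U. (c u)\<^sup>2 + (s u)\<^sup>2 = 1 \<and> (d u)\<^sup>2 + m\<^sup>2 * (s u)\<^sup>2 = 1"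
proof -
  note near = jacobi_sol_near_0[OF assms(1,2,4)]
  have init: "s 0 = 0" "c 0 = 1" "d 0 = 1"
    and mero: "s meromorphic_on U" "c meromorphic_on U" "d meromorphic_on U"
    using assms by (auto simp: jacobi_sol_def)
  have "\<forall>\<^sub>F u in nhds 0. ((\<lambda>u. (c u)\<^sup>2 + (s u)\<^sup>2) has_field_derivative 0) (at u)"
    using near(1,2) by eventually_elim (auto intro!: derivative_eq_intros)
  from eventually_const_of_deriv_0[OF this]
  have *: "\<forall>\<^sub>F u in at 0. (c u)\<^sup>2 + (s u)\<^sup>2 = 1"
    by (simp add: init eventually_nhds_conv_at)
  have "\<forall>\<^sub>F u in nhds 0. ((\<lambda>u. (d u)\<^sup>2 + m\<^sup>2 * (s u)\<^sup>2) has_field_derivative 0) (at u)"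
    using near(1,3) by eventually_elim (auto intro!: derivative_eq_intros)
  from eventually_const_of_deriv_0[OF this]
  have **: "\<forall>\<^sub>F u in at 0. (d u)\<^sup>2 + m\<^sup>2 * (s u)\<^sup>2 = 1"
    by (simp add: init eventually_nhds_conv_at)
  have "\<forall>\<^sub>\<approx>u\<in>U. (c u)\<^sup>2 + (s u)\<^sup>2 = 1" "\<forall>\<^sub>\<approx>u\<in>U. (d u)\<^sup>2 + m\<^sup>2 * (s u)\<^sup>2 = 1"
    by (rule cosparse_eq_meromorphicI[OF _ assms(2-4)]; (intro meromorphic_intros mero | fact))+
  then show ?thesis
    by (rule eventually_conj)
qed

lemma analytic_eq_near_of_higher_deriv_eq:
  assumes "f analytic_on {z}" "g analytic_on {z}" "\<And>n. (deriv ^^ n) f z = (deriv ^^ n) g z"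
  shows "\<forall>\<^sub>F u in nhds z. f u = g u"
proof -
  obtain e1 e2 where "e1 > 0" "f holomorphic_on ball z e1" "e2 > 0" "g holomorphic_on ball z e2"
    using assms(1,2) by (auto simp: analytic_on_def)
  then have *: "f holomorphic_on ball z (min e1 e2)" "g holomorphic_on ball z (min e1 e2)"
    by (auto elim: holomorphic_on_subset)
  have "\<forall>\<^sub>F u in nhds z. u \<in> ball z (min e1 e2)"
    using \<open>e1 > 0\<close> \<open>e2 > 0\<close> by (intro eventually_nhds_in_open) auto
  then show ?thesis
    by eventually_elim (rule holomorphic_fun_eq_on_ball[OF * _ assms(3)])
qed

text \<open>Turns a differential equation near \<open>z\<close> into a recursion for the Taylor
  coefficients at \<open>z\<close>.\<close>

lemma higher_deriv_Suc_eqI: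
  assumes "\<forall>\<^sub>F u in nhds z. (f has_field_derivative g u) (at u)"
  shows "(deriv ^^ Suc n) f z = (deriv ^^ n) g z"
proof -
  have "\<forall>\<^sub>F u in nhds z. deriv f u = g u"
    using assms by eventually_elim (rule DERIV_imp_deriv)
  then have "(deriv ^^ n) (deriv f) z = (deriv ^^ n) g z"
    by (intro higher_deriv_cong_ev) auto
  then show ?thesis
    by (simp add: funpow_Suc_right del: funpow.simps)
qed

text \<open>By the equations, a derivative of order \<open>Suc l\<close> is, up to a constant
  factor, a derivative of order \<open>l\<close> of a product of two of the functions. The Leibniz
  rule expresses it through derivatives of order at most \<open>l\<close>, so strong induction
  applies to the three functions at once.\<close>

lemma jacobi_sol_higher_deriv_0_unique:
  assumes "jacobi_sol m U s c d" "jacobi_sol m U s' c' d'" "open U" "0 \<in> U"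
  shows "(deriv ^^ n) s 0 = (deriv ^^ n) s' 0 \<and> (deriv ^^ n) c 0 = (deriv ^^ n) c' 0 \<and>
         (deriv ^^ n) d 0 = (deriv ^^ n) d' 0"
proof (induction n rule: less_induct)
  case (less n)
  show ?case
  proof (cases n)
    case 0
    then show ?thesis
      using assms by (simp add: jacobi_sol_def)
  next
    case (Suc l)
    note near = jacobi_sol_near_0[OF assms(1,3,4)] jacobi_sol_near_0[OF assms(2-4)]
    have an: "s analytic_on {0}" "c analytic_on {0}" "d analytic_on {0}"
      "s' analytic_on {0}" "c' analytic_on {0}" "d' analytic_on {0}"
      using assms by (auto simp: jacobi_sol_def)
    have eq: "(deriv ^^ i) s 0 = (deriv ^^ i) s' 0" "(deriv ^^ i) c 0 = (deriv ^^ i) c' 0"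
      "(deriv ^^ i) d 0 = (deriv ^^ i) d' 0" if "i \<le> l" for i
      using less.IH[of i] that Suc by auto
    have prod: "(deriv ^^ l) (\<lambda>u. f u * g u) 0 = (deriv ^^ l) (\<lambda>u. f' u * g' u) 0"
      if "f analytic_on {0}" "g analytic_on {0}" "f' analytic_on {0}" "g' analytic_on {0}"
        "\<And>i. i \<le> l \<Longrightarrow> (deriv ^^ i) f 0 = (deriv ^^ i) f' 0"
        "\<And>i. i \<le> l \<Longrightarrow> (deriv ^^ i) g 0 = (deriv ^^ i) g' 0" for f g f' g' :: "complex \<Rightarrow> complex"
      using that by (simp add: higher_deriv_mult_at)
    have scale: "(deriv ^^ i) (\<lambda>u. a * f u) 0 = a * (deriv ^^ i) f 0"
      if "f analytic_on {0}" for f :: "complex \<Rightarrow> complex" and a i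
      using that higher_deriv_cmult' by blast
    have "(deriv ^^ n) s 0 = (deriv ^^ n) s' 0"
      unfolding Suc higher_deriv_Suc_eqI[OF near(1)] higher_deriv_Suc_eqI[OF near(4)]
      by (intro prod an eq)
    moreover have "(deriv ^^ n) c 0 = (deriv ^^ n) c' 0"
      unfolding Suc higher_deriv_Suc_eqI[OF near(2)] higher_deriv_Suc_eqI[OF near(5)]
      using prod[of s d s' d'] an eq
      by (simp add: higher_deriv_uminus_at analytic_intros)
    moreover have "(deriv ^^ n) d 0 = (deriv ^^ n) d' 0"
      unfolding Suc higher_deriv_Suc_eqI[OF near(3)] higher_deriv_Suc_eqI[OF near(6)]
      using prod[of "\<lambda>u. m\<^sup>2 * s u" c "\<lambda>u. m\<^sup>2 * s' u" c'] an eq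
      by (simp add: higher_deriv_uminus_at scale analytic_intros)
    ultimately show ?thesis by blast
  qed
qed

text \<open>Equal Taylor coefficients give equality near 0, and the identity theorem for the
  differences extends it to the connected set \<open>U\<close>.\<close>

lemma jacobi_sol_unique:
  assumes "jacobi_sol m U s c d" "jacobi_sol m U s' c' d'" "open U" "connected U" "0 \<in> U"
  shows "\<forall>\<^sub>\<approx>u\<in>U. s u = s' u \<and> c u = c' u \<and> d u = d' u"
proof -
  note hd = jacobi_sol_higher_deriv_0_unique[OF assms(1-3,5)]
  have eq: "\<forall>\<^sub>\<approx>u\<in>U. f u = g u"
    if "f meromorphic_on U" "g meromorphic_on U" "f analytic_on {0}" "g analytic_on {0}"
      "\<And>n. (deriv ^^ n) f 0 = (deriv ^^ n) g 0" for f g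
  proof -
    have "\<forall>\<^sub>F u in at 0. f u = g u"
      using analytic_eq_near_of_higher_deriv_eq[OF that(3-5)] by (simp add: eventually_nhds_conv_at)
    then have "\<forall>\<^sub>\<approx>u\<in>U. f u - g u = 0"
      using that(1,2) assms(3-5) by (intro cosparse_eq_meromorphicI[of _ _ 0] meromorphic_intros) auto
    then show ?thesis by simp
  qed
  show ?thesis
    using assms(1,2) hd by (intro eventually_conj eq) (auto simp: jacobi_sol_def)
qed

subsection \<open>Duplication\<close>

text \<open>The hypothesis \<open>ode\<close> is the Jacobi system with its right-hand sides
  multiplied by \<open>a\<close>; substituting \<open>u / a\<close> cancels this factor. Duplication
  takes \<open>a = 2\<close>, and the change of modulus takes a square root of
  \<open>1 - m\<^sup>2\<close>.\<close>

lemma jacobi_sol_scaleI: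
  assumes mero: "s meromorphic_on U" "c meromorphic_on U" "d meromorphic_on U"
    and an: "s analytic_on {0}" "c analytic_on {0}" "d analytic_on {0}"
    and init: "s 0 = 0" "c 0 = 1" "d 0 = 1"
    and ode: "\<forall>\<^sub>\<approx>v\<in>U. (s has_field_derivative a * (c v * d v)) (at v) \<and>
        (c has_field_derivative - (a * (s v * d v))) (at v) \<and>
        (d has_field_derivative - (a * (m\<^sup>2 * s v * c v))) (at v)"
    and U: "open U" "open V" "a \<noteq> 0" "\<And>u. u \<in> V \<Longrightarrow> inverse a * u \<in> U"
  shows "jacobi_sol m V (\<lambda>u. s (inverse a * u)) (\<lambda>u. c (inverse a * u)) (\<lambda>u. d (inverse a * u))"
proof -
  have mero': "(\<lambda>u. f (inverse a * u)) meromorphic_on V" if "f meromorphic_on U" for f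
    using U(4) by (intro meromorphic_on_compose[OF that]) (auto intro!: analytic_intros)
  have an': "(\<lambda>u. f (inverse a * u)) analytic_on {0}" if "f analytic_on {0}" for f :: "complex \<Rightarrow> complex"
    using analytic_on_compose_gen[OF _ that, of "\<lambda>u. inverse a * u" "{0}"]
    by (simp add: o_def analytic_intros)
  have "\<forall>\<^sub>\<approx>u\<in>V. (s has_field_derivative a * (c (inverse a * u) * d (inverse a * u))) (at (inverse a * u)) \<and>
        (c has_field_derivative - (a * (s (inverse a * u) * d (inverse a * u)))) (at (inverse a * u)) \<and>
        (d has_field_derivative - (a * (m\<^sup>2 * s (inverse a * u) * c (inverse a * u)))) (at (inverse a * u))"
    using U by (intro cosparse_scale[OF ode]) auto
  then have "\<forall>\<^sub>\<approx>u\<in>V.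
       ((\<lambda>u. s (inverse a * u)) has_field_derivative c (inverse a * u) * d (inverse a * u)) (at u) \<and>
       ((\<lambda>u. c (inverse a * u)) has_field_derivative - (s (inverse a * u) * d (inverse a * u))) (at u) \<and>
       ((\<lambda>u. d (inverse a * u)) has_field_derivative - (m\<^sup>2 * s (inverse a * u) * c (inverse a * u))) (at u)"
  proof eventually_elim
    case (elim u)
    have chain: "((\<lambda>u. f (inverse a * u)) has_field_derivative D) (at u)"
      if "(f has_field_derivative D') (at (inverse a * u))" "D' = a * D" for f D D'
      using DERIV_chain2[of f D' "\<lambda>u. inverse a * u" u "inverse a" UNIV] that \<open>a \<noteq> 0\<close>
      by (auto simp: DERIV_cmult_Id elim!: DERIV_cong)
    from elim show ?case
      by (intro conjI chain) (auto simp: mult_ac)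
  qed
  then show ?thesis
    using mero an init by (simp add: jacobi_sol_def mero' an')
qed

text \<open>The left-hand sides are the numerators that the quotient rule produces for the
  duplication formulas with common denominator \<open>1 - m\<^sup>2 * s ^ 4\<close>. The right-hand
  sides are what the Jacobi system at the doubled argument demands, the factor 2 coming from the
  chain rule.\<close>

lemma duplication_identities:
  fixes s c d m :: complex
  assumes "c\<^sup>2 + s\<^sup>2 = 1" "d\<^sup>2 + m\<^sup>2 * s\<^sup>2 = 1"
  shows "(2 * (c\<^sup>2 * d\<^sup>2 - s\<^sup>2 * d\<^sup>2 - m\<^sup>2 * s\<^sup>2 * c\<^sup>2)) * (1 - m\<^sup>2 * s ^ 4) - 2 * s * c * d * (- 4 * m\<^sup>2 * s ^ 3 * c * d)
      = 2 * ((c\<^sup>2 - s\<^sup>2 * d\<^sup>2) * (d\<^sup>2 - m\<^sup>2 * s\<^sup>2 * c\<^sup>2))" (is ?A)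
    and "(2 * s * c * d * (m\<^sup>2 * s\<^sup>2 - d\<^sup>2 - 1)) * (1 - m\<^sup>2 * s ^ 4) - (c\<^sup>2 - s\<^sup>2 * d\<^sup>2) * (- 4 * m\<^sup>2 * s ^ 3 * c * d)
      = - (2 * (2 * s * c * d * (d\<^sup>2 - m\<^sup>2 * s\<^sup>2 * c\<^sup>2)))" (is ?B)
    and "(2 * m\<^sup>2 * s * c * d * (s\<^sup>2 - c\<^sup>2 - 1)) * (1 - m\<^sup>2 * s ^ 4) - (d\<^sup>2 - m\<^sup>2 * s\<^sup>2 * c\<^sup>2) * (- 4 * m\<^sup>2 * s ^ 3 * c * d)
      = - (2 * (m\<^sup>2 * (2 * s * c * d) * (c\<^sup>2 - s\<^sup>2 * d\<^sup>2)))" (is ?C)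
proof -
  \<comment> \<open>Once \<open>c\<^sup>2\<close> and \<open>d\<^sup>2\<close> are eliminated, these
    are polynomial identities in \<open>x\<close> and \<open>y\<close>. The second and third are odd
    in \<open>s\<close>, \<open>c\<close> and \<open>d\<close>, so the common factor
    \<open>s * c * d\<close> is split off first.\<close>
  define x y where "x = s\<^sup>2" and "y = m\<^sup>2"
  have c2: "c\<^sup>2 = 1 - x" and d2: "d\<^sup>2 = 1 - y * x"
    using assms by (simp_all add: x_def y_def eq_diff_eq)
  have "?A \<longleftrightarrow> 2 * (c\<^sup>2 * d\<^sup>2 - x * d\<^sup>2 - y * x * c\<^sup>2) * (1 - y * x\<^sup>2) + 8 * y * x\<^sup>2 * c\<^sup>2 * d\<^sup>2
      = 2 * ((c\<^sup>2 - x * d\<^sup>2) * (d\<^sup>2 - y * x * c\<^sup>2))"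
    by (simp add: x_def y_def algebra_simps power2_eq_square power3_eq_cube power4_eq_xxxx)
  then show ?A
    unfolding c2 d2 by (simp add: algebra_simps power2_eq_square)
  have "(y * x - d\<^sup>2 - 1) * (1 - y * x\<^sup>2) + 2 * y * x * (c\<^sup>2 - x * d\<^sup>2) = - 2 * (d\<^sup>2 - y * x * c\<^sup>2)"
    unfolding c2 d2 by (simp add: algebra_simps power2_eq_square)
  then have "2 * s * c * d * ((y * x - d\<^sup>2 - 1) * (1 - y * x\<^sup>2) + 2 * y * x * (c\<^sup>2 - x * d\<^sup>2))
      = 2 * s * c * d * (- 2 * (d\<^sup>2 - y * x * c\<^sup>2))"
    by (rule arg_cong)
  then show ?B
    by (simp add: x_def y_def algebra_simps power2_eq_square power3_eq_cube power4_eq_xxxx)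
  have "(x - c\<^sup>2 - 1) * (1 - y * x\<^sup>2) + 2 * x * (d\<^sup>2 - y * x * c\<^sup>2) = - 2 * (c\<^sup>2 - x * d\<^sup>2)"
    unfolding c2 d2 by (simp add: algebra_simps power2_eq_square)
  then have "2 * y * s * c * d * ((x - c\<^sup>2 - 1) * (1 - y * x\<^sup>2) + 2 * x * (d\<^sup>2 - y * x * c\<^sup>2))
      = 2 * y * s * c * d * (- 2 * (c\<^sup>2 - x * d\<^sup>2))"
    by (rule arg_cong)
  then show ?C
    by (simp add: x_def y_def algebra_simps power2_eq_square power3_eq_cube power4_eq_xxxx)
qed

text \<open>The duplication formulas evaluated at \<open>u / 2\<close> need the old solution only on
  the disc of half the radius.\<close>

lemma jacobi_sol_double:
  assumes "jacobi_sol m (ball 0 r) s c d" "r > 0"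
  shows "\<exists>s c d. jacobi_sol m (ball 0 (r * 2)) s c d"
proof -
  let ?U = "ball (0 :: complex) r"
  \<comment> \<open>The classical formulas are sn(2v) = \<open>n1 v / q v\<close>, cn(2v) =
    \<open>n2 v / q v\<close> and dn(2v) = \<open>n3 v / q v\<close>.\<close>
  define q where "q v = 1 - m\<^sup>2 * s v ^ 4" for v
  define n1 where "n1 v = 2 * s v * c v * d v" for v
  define n2 where "n2 v = (c v)\<^sup>2 - (s v)\<^sup>2 * (d v)\<^sup>2" for v
  define n3 where "n3 v = (d v)\<^sup>2 - m\<^sup>2 * (s v)\<^sup>2 * (c v)\<^sup>2" for v
  have mero: "s meromorphic_on ?U" "c meromorphic_on ?U" "d meromorphic_on ?U"
    and an: "s analytic_on {0}" "c analytic_on {0}" "d analytic_on {0}"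
    and init: "s 0 = 0" "c 0 = 1" "d 0 = 1"
    and ode: "\<forall>\<^sub>\<approx>u\<in>?U. (s has_field_derivative c u * d u) (at u) \<and>
        (c has_field_derivative - (s u * d u)) (at u) \<and>
        (d has_field_derivative - (m\<^sup>2 * s u * c u)) (at u)"
    using assms by (auto simp: jacobi_sol_def)
  have qmero: "q meromorphic_on ?U" and nmero: "n1 meromorphic_on ?U" "n2 meromorphic_on ?U" "n3 meromorphic_on ?U"
    unfolding q_def n1_def n2_def n3_def by (intro meromorphic_intros mero)+
  have qan: "q analytic_on {0}" and nan: "n1 analytic_on {0}" "n2 analytic_on {0}" "n3 analytic_on {0}"
    unfolding q_def n1_def n2_def n3_def by (intro analytic_intros an)+
  have init': "q 0 = 1" "n1 0 = 0" "n2 0 = 1" "n3 0 = 1"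
    by (simp_all add: q_def n1_def n2_def n3_def init)
  have "\<forall>\<^sub>\<approx>v\<in>?U. q v \<noteq> 0"
    using qmero qan init' \<open>r > 0\<close>
    by (intro cosparse_neq_meromorphicI[of _ _ 0]) (auto intro: analytic_at_imp_isCont)
  moreover have "\<forall>\<^sub>\<approx>u\<in>?U. (c u)\<^sup>2 + (s u)\<^sup>2 = 1 \<and> (d u)\<^sup>2 + m\<^sup>2 * (s u)\<^sup>2 = 1"
    by (rule jacobi_sol_squares[OF assms(1)]) (use \<open>r > 0\<close> in auto)
  ultimately have "\<forall>\<^sub>\<approx>v\<in>?U.
        ((\<lambda>v. n1 v / q v) has_field_derivative 2 * (n2 v / q v * (n3 v / q v))) (at v) \<and>
        ((\<lambda>v. n2 v / q v) has_field_derivative - (2 * (n1 v / q v * (n3 v / q v)))) (at v) \<and>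
        ((\<lambda>v. n3 v / q v) has_field_derivative - (2 * (m\<^sup>2 * (n1 v / q v) * (n2 v / q v)))) (at v)"
    using ode
  proof eventually_elim
    case (elim v)
    then have sq: "(c v)\<^sup>2 + (s v)\<^sup>2 = 1" "(d v)\<^sup>2 + m\<^sup>2 * (s v)\<^sup>2 = 1" and qv: "q v \<noteq> 0"
      and der: "(s has_field_derivative c v * d v) (at v)"
        "(c has_field_derivative - (s v * d v)) (at v)"
        "(d has_field_derivative - (m\<^sup>2 * s v * c v)) (at v)"
      by auto
    note id = duplication_identities[OF sq, folded n1_def n2_def n3_def q_def]
    have dq: "(q has_field_derivative - 4 * m\<^sup>2 * s v ^ 3 * c v * d v) (at v)"
      unfolding q_def by (rule derivative_eq_intros der refl)+ (simp add: algebra_simps)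
    have dn1: "(n1 has_field_derivative 2 * ((c v)\<^sup>2 * (d v)\<^sup>2 - (s v)\<^sup>2 * (d v)\<^sup>2 - m\<^sup>2 * (s v)\<^sup>2 * (c v)\<^sup>2)) (at v)"
      unfolding n1_def
      by (rule DERIV_cong, (rule derivative_intros der)+) (simp add: algebra_simps power2_eq_square)
    have dn2: "(n2 has_field_derivative n1 v * (m\<^sup>2 * (s v)\<^sup>2 - (d v)\<^sup>2 - 1)) (at v)"
      unfolding n1_def n2_def
      by (rule DERIV_cong, (rule derivative_intros der)+) (simp add: algebra_simps power2_eq_square)
    have dn3: "(n3 has_field_derivative 2 * m\<^sup>2 * s v * c v * d v * ((s v)\<^sup>2 - (c v)\<^sup>2 - 1)) (at v)"
      unfolding n3_def
      by (rule DERIV_cong, (rule derivative_intros der)+) (simp add: algebra_simps power2_eq_square)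
    have quot: "((\<lambda>v. n v / q v) has_field_derivative N / (q v * q v)) (at v)"
      if "(n has_field_derivative n') (at v)" "n' * q v - n v * (- 4 * m\<^sup>2 * s v ^ 3 * c v * d v) = N" for n n' N
      using DERIV_divide[OF that(1) dq qv] that(2) by simp
    show ?case
      using quot[OF dn1 id(1)] quot[OF dn2 id(2)] quot[OF dn3 id(3)]
      by simp
  qed
  then have "jacobi_sol m (ball 0 (r * 2)) (\<lambda>u. n1 (inverse 2 * u) / q (inverse 2 * u))
      (\<lambda>u. n2 (inverse 2 * u) / q (inverse 2 * u)) (\<lambda>u. n3 (inverse 2 * u) / q (inverse 2 * u))"
    using init' by (intro jacobi_sol_scaleI[where U = ?U and a = 2])
      (auto intro!: meromorphic_intros analytic_intros qmero nmero qan nan)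
  then show ?thesis by blast
qed

subsection \<open>Existence\<close>

text \<open>The local inverse \<open>g\<close> of the elliptic integral of
  \<open>1 / (C z * D z)\<close> from 0 plays the role of sn, and \<open>C (g u)\<close>,
  \<open>D (g u)\<close> those of cn and dn.\<close>

lemma jacobi_sol_local_exists: "\<exists>r>0. \<exists>s c d. jacobi_sol m (ball 0 r) s c d"
proof -
  \<comment> \<open>On \<open>A\<close> both radicands have positive real part, so they stay off the
    branch cut of \<open>csqrt\<close>, and \<open>C\<close> and \<open>D\<close> are holomorphic
    without zeros.\<close>
  define A where "A = {z. 0 < Re (1 - z\<^sup>2)} \<inter> {z. 0 < Re (1 - m\<^sup>2 * z\<^sup>2)}"
  have "open A"
    unfolding A_def by (intro open_Int open_Collect_less continuous_intros)
  moreover have "0 \<in> A"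
    by (simp add: A_def)
  ultimately obtain \<rho> where \<rho>: "\<rho> > 0" "ball 0 \<rho> \<subseteq> A"
    using open_contains_ball by blast
  have slit: "1 - z\<^sup>2 \<notin> \<real>\<^sub>\<le>\<^sub>0" "1 - m\<^sup>2 * z\<^sup>2 \<notin> \<real>\<^sub>\<le>\<^sub>0" if "z \<in> ball 0 \<rho>" for z
    using that \<rho>(2) by (auto simp: A_def complex_nonpos_Reals_iff)
  define C D where "C z = csqrt (1 - z\<^sup>2)" and "D z = csqrt (1 - m\<^sup>2 * z\<^sup>2)" for z
  have nz: "C z \<noteq> 0" "D z \<noteq> 0" if "z \<in> ball 0 \<rho>" for z
    using slit[OF that] by (auto simp: C_def D_def)
  have hol_inv: "(\<lambda>z. 1 / (C z * D z)) holomorphic_on ball 0 \<rho>"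
    using slit nz unfolding C_def D_def by (intro holomorphic_intros) auto
  have "\<exists>F0. \<forall>z\<in>ball 0 \<rho>. (F0 has_field_derivative 1 / (C z * D z)) (at z within ball 0 \<rho>)"
    by (rule holomorphic_convex_primitive'[OF convex_ball open_ball hol_inv]) (intro exI ballI)
  then obtain F0 where F0: "\<forall>z\<in>ball 0 \<rho>. (F0 has_field_derivative 1 / (C z * D z)) (at z within ball 0 \<rho>)"
    by (elim exE)
  \<comment> \<open>This primitive is normalised to vanish at 0, so that its inverse satisfies
    \<open>g 0 = 0\<close>.\<close>
  define F where "F z = F0 z - F0 0" for z
  have F: "(F has_field_derivative 1 / (C z * D z)) (at z)" if "z \<in> ball 0 \<rho>" for z
  proof -
    have "(F0 has_field_derivative 1 / (C z * D z)) (at z)"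
      using bspec[OF F0 that] at_within_open[OF that open_ball] by simp
    from DERIV_diff[OF this DERIV_const[of "F0 0"]] show ?thesis
      by (simp add: F_def[abs_def])
  qed
  then have holF: "F holomorphic_on ball 0 \<rho>"
    unfolding holomorphic_on_open[OF open_ball] by blast
  \<comment> \<open>The derivative at 0 is 1, because \<open>C 0 = D 0 = 1\<close>; this makes
    \<open>F\<close> locally invertible.\<close>
  have "deriv F 0 \<noteq> 0"
    using DERIV_imp_deriv[OF F, of 0] nz[of 0] \<rho>(1) by simp
  then have "\<exists>r>0. ball (0::complex) r \<subseteq> ball 0 \<rho> \<and> open (F ` ball 0 r) \<and> inj_on F (ball 0 r)"
    by (rule has_complex_derivative_locally_invertible[OF holF centre_in_ball[THEN iffD2, OF \<rho>(1)] open_ball])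
      (intro exI conjI)
  then obtain r where r: "r > 0" "ball (0::complex) r \<subseteq> ball 0 \<rho>" "open (F ` ball 0 r)" "inj_on F (ball 0 r)"
    by blast
  have "\<exists>g. g holomorphic_on F ` ball 0 r \<and>
      (\<forall>z\<in>ball 0 r. deriv F z * deriv g (F z) = 1) \<and> (\<forall>z\<in>ball 0 r. g (F z) = z)"
    by (rule holomorphic_has_inverse[OF holomorphic_on_subset[OF holF r(2)] open_ball r(4)])
      (intro exI conjI ballI)
  then obtain g where g: "g holomorphic_on F ` ball 0 r"
      "\<forall>z\<in>ball 0 r. deriv F z * deriv g (F z) = 1" "\<forall>z\<in>ball 0 r. g (F z) = z"
    by (elim exE conjE)
  have F_0: "F 0 = 0"
    by (simp add: F_def)
  then have "0 \<in> F ` ball 0 r"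
    using r(1) by (metis centre_in_ball imageI)
  then obtain e where e: "e > 0" "ball 0 e \<subseteq> F ` ball 0 r"
    using r(3) open_contains_ball by blast
  have g_0: "g 0 = 0"
    using bspec[OF g(3), of 0] r(1) F_0 by simp
  \<comment> \<open>The inverse function rule: the derivative of \<open>g\<close> at
    \<open>u\<close> is the reciprocal of the integrand at \<open>g u\<close>.\<close>
  have dg: "(g has_field_derivative C (g u) * D (g u)) (at u)" and gu: "g u \<in> ball 0 \<rho>" if "u \<in> ball 0 e" for u
  proof -
    have "u \<in> F ` ball 0 r"
      using that e(2) by blast
    then obtain z where z: "z \<in> ball 0 r" "u = F z"
      by blast
    then have gz: "g u = z" and z\<rho>: "z \<in> ball 0 \<rho>"
      using g(3) r(2) by auto
    then show "g u \<in> ball 0 \<rho>" by simp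
    have "deriv g u = C (g u) * D (g u)"
      using bspec[OF g(2) z(1)] DERIV_imp_deriv[OF F[OF z\<rho>]] nz[OF z\<rho>] gz z(2) by (simp add: field_simps)
    then show "(g has_field_derivative C (g u) * D (g u)) (at u)"
      using holomorphic_derivI[OF g(1) r(3)] that e(2) by (metis subsetD)
  qed
  have dC: "((\<lambda>u. C (g u)) has_field_derivative - (g u * D (g u))) (at u)"
    and dD: "((\<lambda>u. D (g u)) has_field_derivative - (m\<^sup>2 * g u * C (g u))) (at u)" if "u \<in> ball 0 e" for u
  proof -
    note gu = gu[OF that]
    have "((\<lambda>u. (g u)\<^sup>2) has_field_derivative 2 * g u * (C (g u) * D (g u))) (at u)"
      using DERIV_power[OF dg[OF that], of 2] by (simp add: mult_ac)
    note sq = this DERIV_cmult[OF this, of "m\<^sup>2"]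
    have "((\<lambda>u. csqrt (1 - (g u)\<^sup>2)) has_field_derivative
        (0 - 2 * g u * (C (g u) * D (g u))) / (2 * C (g u))) (at u)"
      unfolding C_def[of "g u"]
      by (rule has_field_derivative_csqrt'[OF DERIV_diff[OF DERIV_const sq(1)[unfolded C_def]] slit(1)[OF gu]])
    then show "((\<lambda>u. C (g u)) has_field_derivative - (g u * D (g u))) (at u)"
      using nz[OF gu] by (simp add: C_def[abs_def])
    have "((\<lambda>u. csqrt (1 - m\<^sup>2 * (g u)\<^sup>2)) has_field_derivative
        (0 - m\<^sup>2 * (2 * g u * (C (g u) * D (g u)))) / (2 * D (g u))) (at u)"
      unfolding D_def[of "g u"]
      by (rule has_field_derivative_csqrt'[OF DERIV_diff[OF DERIV_const sq(2)[unfolded D_def]] slit(2)[OF gu]])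
    then show "((\<lambda>u. D (g u)) has_field_derivative - (m\<^sup>2 * g u * C (g u))) (at u)"
      using nz[OF gu] by (simp add: D_def[abs_def] mult.assoc)
  qed
  have hol: "g holomorphic_on ball 0 e" "(\<lambda>u. C (g u)) holomorphic_on ball 0 e" "(\<lambda>u. D (g u)) holomorphic_on ball 0 e"
    unfolding holomorphic_on_open[OF open_ball] using dg dC dD by blast+
  then have an: "g analytic_on ball 0 e" "(\<lambda>u. C (g u)) analytic_on ball 0 e" "(\<lambda>u. D (g u)) analytic_on ball 0 e"
    by (simp_all add: analytic_on_open)
  have "jacobi_sol m (ball 0 e) g (\<lambda>u. C (g u)) (\<lambda>u. D (g u))"
    unfolding jacobi_sol_def
  proof (intro conjI)
    show "\<forall>\<^sub>\<approx>u\<in>ball 0 e. (g has_field_derivative C (g u) * D (g u)) (at u) \<and>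
        ((\<lambda>u. C (g u)) has_field_derivative - (g u * D (g u))) (at u) \<and>
        ((\<lambda>u. D (g u)) has_field_derivative - (m\<^sup>2 * g u * C (g u))) (at u)"
      using eventually_in_cosparse[OF order_refl open_ball]
      by (rule eventually_mono) (use dg dC dD in blast)
  qed (use an e(1) g_0 in \<open>auto simp: C_def D_def intro: analytic_on_imp_meromorphic_on analytic_on_subset\<close>)
  with e(1) show ?thesis by blast
qed

section \<open>Gluing solutions over growing discs\<close>

text \<open>Every condition in \<open>jacobi_sol\<close> depends only on germs at points of the open
  set \<open>U\<close>. This is what allows a function glued from several discs to be treated on
  each disc separately.\<close>

lemma jacobi_sol_cong:
  assumes "jacobi_sol m U s c d" "open U" "0 \<in> U"
    and eq: "\<And>u. u \<in> U \<Longrightarrow> s' u = s u" "\<And>u. u \<in> U \<Longrightarrow> c' u = c u" "\<And>u. u \<in> U \<Longrightarrow> d' u = d u"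
  shows "jacobi_sol m U s' c' d'"
proof -
  have near: "\<forall>\<^sub>F w in nhds u. f' w = f w" if "u \<in> U" "\<And>u. u \<in> U \<Longrightarrow> f' u = f u" for u and f f' :: "complex \<Rightarrow> complex"
    using eventually_nhds_in_open[OF \<open>open U\<close> that(1)] by eventually_elim (rule that(2))
  have mero: "f' meromorphic_on U" if "f meromorphic_on U" "\<And>u. u \<in> U \<Longrightarrow> f' u = f u" for f f'
    using that near[OF _ that(2)] meromorphic_on_cong[of U f' f U] by (simp add: eventually_nhds_conv_at)
  have an: "f' analytic_on {0}" if "f analytic_on {0}" "\<And>u. u \<in> U \<Longrightarrow> f' u = f u" for f f'
    using that(1) analytic_at_cong[OF near[OF \<open>0 \<in> U\<close> that(2)] refl] by simp
  have der: "(f' has_field_derivative D) (at u)"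
    if "(f has_field_derivative D) (at u)" "u \<in> U" "\<And>u. u \<in> U \<Longrightarrow> f' u = f u" for f f' :: "complex \<Rightarrow> complex" and D u
    using that(1) DERIV_cong_ev[OF refl near[OF that(2,3)] refl] by simp
  have ode: "\<forall>\<^sub>\<approx>u\<in>U. (s has_field_derivative c u * d u) (at u) \<and>
        (c has_field_derivative - (s u * d u)) (at u) \<and>
        (d has_field_derivative - (m\<^sup>2 * s u * c u)) (at u)"
    using assms(1) by (simp add: jacobi_sol_def)
  have "\<forall>\<^sub>\<approx>u\<in>U. u \<in> U"
    using \<open>open U\<close> by (intro eventually_in_cosparse) auto
  with ode have "\<forall>\<^sub>\<approx>u\<in>U. (s' has_field_derivative c' u * d' u) (at u) \<and>
        (c' has_field_derivative - (s' u * d' u)) (at u) \<and>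
        (d' has_field_derivative - (m\<^sup>2 * s' u * c' u)) (at u)"
    by eventually_elim (simp add: eq der[OF _ _ eq(1)] der[OF _ _ eq(2)] der[OF _ _ eq(3)])
  then show ?thesis
    using assms(1) eq \<open>0 \<in> U\<close> unfolding jacobi_sol_def by (auto intro: mero an)
qed

lemma jacobi_sol_subset:
  assumes "jacobi_sol m U s c d" "V \<subseteq> U" "open U" "open V"
  shows "jacobi_sol m V s c d"
  using assms by (auto simp: jacobi_sol_def eventually_cosparse_open_eq intro: meromorphic_on_subset)

text \<open>Off a discrete set all three functions are analytic, and there
  \<open>remove_sings\<close> changes nothing in a whole neighbourhood.\<close>

lemma jacobi_sol_remove_sings:
  assumes "jacobi_sol m U s c d" "open U" "0 \<in> U"
  shows "jacobi_sol m U (remove_sings s) (remove_sings c) (remove_sings d)"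
proof -
  have mero: "s meromorphic_on U" "c meromorphic_on U" "d meromorphic_on U"
    and an: "s analytic_on {0}" "c analytic_on {0}" "d analytic_on {0}"
    using assms by (auto simp: jacobi_sol_def)
  have der: "(remove_sings f has_field_derivative D) (at u)"
    if "(f has_field_derivative D) (at u)" "f analytic_on {u}" for f D u
    using that(1) DERIV_cong_ev[OF refl eventually_remove_sings_eq_nhds[OF that(2)] refl] by simp
  have ode: "\<forall>\<^sub>\<approx>u\<in>U. (s has_field_derivative c u * d u) (at u) \<and>
        (c has_field_derivative - (s u * d u)) (at u) \<and>
        (d has_field_derivative - (m\<^sup>2 * s u * c u)) (at u)"
    using assms(1) by (simp add: jacobi_sol_def)
  from ode mero[THEN meromorphic_on_imp_analytic_cosparse] have "\<forall>\<^sub>\<approx>u\<in>U. (remove_sings s has_field_derivative remove_sings c u * remove_sings d u) (at u) \<and>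
        (remove_sings c has_field_derivative - (remove_sings s u * remove_sings d u)) (at u) \<and>
        (remove_sings d has_field_derivative - (m\<^sup>2 * remove_sings s u * remove_sings c u)) (at u)"
    by eventually_elim (auto intro!: der)
  then show ?thesis
    using assms(1) mero an by (simp add: jacobi_sol_def remove_sings_analytic_on remove_sings_meromorphic)
qed

lemma jacobi_sol_UN_ball:
  assumes "\<And>n. jacobi_sol m (ball 0 (R n)) s c d" "(\<Union>n. ball 0 (R n)) = (UNIV :: complex set)"
  shows "jacobi_sol m UNIV s c d"
proof -
  have cover: "\<exists>n. u \<in> ball 0 (R n)" for u :: complex
    using assms(2) by blast
  have "f meromorphic_on UNIV" if "\<And>n. f meromorphic_on ball 0 (R n)" for f
    using that cover unfolding meromorphic_on_def by blast
  moreover have "\<forall>\<^sub>\<approx>u\<in>UNIV. P u" if "\<And>n. \<forall>\<^sub>\<approx>u\<in>ball (0::complex) (R n). P u" for P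
    using that cover by (fastforce simp: eventually_cosparse_open_eq)
  ultimately show ?thesis
    using assms(1) unfolding jacobi_sol_def by simp
qed

lemma jacobi_sol_exists: "\<exists>s c d. jacobi_sol m UNIV s c d"
proof -
  obtain r where r: "r > 0" "\<exists>s c d. jacobi_sol m (ball 0 r) s c d"
    using jacobi_sol_local_exists by blast
  define R where "R n = r * 2 ^ n" for n :: nat
  have Rpos: "R n > 0" for n
    using r(1) by (simp add: R_def)
  have "\<exists>s c d. jacobi_sol m (ball 0 (R n)) s c d" for n
  proof (induction n)
    case 0
    then show ?case using r(2) by (simp add: R_def)
  next
    case (Suc n)
    then show ?case
      using jacobi_sol_double[of m "R n"] Rpos[of n] by (auto simp: R_def mult_ac)
  qed
  \<comment> \<open>These solutions are chosen independently for each \<open>n\<close>; only the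
    uniqueness lemma relates them.\<close>
  then obtain s c d where sol: "\<And>n. jacobi_sol m (ball 0 (R n)) (s n) (c n) (d n)"
    by metis
  have cover: "\<exists>n. norm (u :: complex) < R n" for u
    using real_arch_pow[of 2 "norm u / r"] r(1) by (auto simp: R_def field_simps)
  \<comment> \<open>The glued function at \<open>u\<close> uses the first disc that contains
    \<open>u\<close>.\<close>
  define N where "N u = (LEAST n. norm u < R n)" for u :: complex
  have N: "norm u < R (N u)" for u
    unfolding N_def using cover[of u] by (rule LeastI_ex)
  \<comment> \<open>Uniqueness on the smaller disc yields agreement only in a punctured
    neighbourhood of \<open>u\<close>. This suffices, since the glued values below are taken after
    \<open>remove_sings\<close>.\<close>
  have agree: "\<forall>\<^sub>F w in at u. s (N u) w = s n w \<and> c (N u) w = c n w \<and> d (N u) w = d n w"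
    if "u \<in> ball 0 (R n)" for u n
  proof -
    have "N u \<le> n"
      using that unfolding N_def by (intro Least_le) simp
    then have "R (N u) \<le> R n"
      using r(1) by (simp add: R_def)
    then have "jacobi_sol m (ball 0 (R (N u))) (s n) (c n) (d n)"
      by (intro jacobi_sol_subset[OF sol[of n]]) auto
    from jacobi_sol_unique[OF sol this] Rpos N[of u] show ?thesis
      by (simp add: eventually_cosparse_open_eq)
  qed
  define S C D where "S u = remove_sings (s (N u)) u" and "C u = remove_sings (c (N u)) u"
    and "D u = remove_sings (d (N u)) u" for u
  have "jacobi_sol m (ball 0 (R n)) S C D" for n
  proof (rule jacobi_sol_cong)
    show "jacobi_sol m (ball 0 (R n)) (remove_sings (s n)) (remove_sings (c n)) (remove_sings (d n))"
      using sol Rpos by (intro jacobi_sol_remove_sings) auto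
  qed (use Rpos in \<open>auto simp: S_def C_def D_def intro!: remove_sings_cong intro: eventually_mono[OF agree]\<close>)
  then have "jacobi_sol m UNIV S C D"
    by (rule jacobi_sol_UN_ball) (use cover in auto)
  then show ?thesis by blast
qed

section \<open>The normalised global solution is the Jacobi triple\<close>

text \<open>From left to right, meromorphic functions are analytic off a discrete set. From right to
  left, the equations extend by continuity to each point where all three functions are
  analytic.\<close>

lemma is_jacobi_triple_iff:
  "is_jacobi_triple m (s, c, d) \<longleftrightarrow> jacobi_sol m UNIV s c d \<and>
     s nicely_meromorphic_on UNIV \<and> c nicely_meromorphic_on UNIV \<and> d nicely_meromorphic_on UNIV"
  (is "?L \<longleftrightarrow> ?R")
proof
  assume L: ?L
  then have mero: "s meromorphic_on UNIV" "c meromorphic_on UNIV" "d meromorphic_on UNIV"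
    and ode: "\<And>u. s analytic_on {u} \<Longrightarrow> c analytic_on {u} \<Longrightarrow> d analytic_on {u} \<Longrightarrow>
        (s has_field_derivative c u * d u) (at u) \<and>
        (c has_field_derivative - (s u * d u)) (at u) \<and>
        (d has_field_derivative - (m\<^sup>2 * s u * c u)) (at u)"
    by (simp_all add: is_jacobi_triple_def nicely_meromorphic_on_def)
  from mero[THEN meromorphic_on_imp_analytic_cosparse]
  have "\<forall>\<^sub>\<approx>u\<in>UNIV. (s has_field_derivative c u * d u) (at u) \<and>
        (c has_field_derivative - (s u * d u)) (at u) \<and>
        (d has_field_derivative - (m\<^sup>2 * s u * c u)) (at u)"
    by eventually_elim (rule ode)
  then show ?R
    using L mero by (simp add: is_jacobi_triple_def jacobi_sol_def)
next
  assume R: ?R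
  have "(s has_field_derivative c u * d u) (at u) \<and>
        (c has_field_derivative - (s u * d u)) (at u) \<and>
        (d has_field_derivative - (m\<^sup>2 * s u * c u)) (at u)"
    if an: "s analytic_on {u}" "c analytic_on {u}" "d analytic_on {u}" for u
  proof -
    have ode: "\<forall>\<^sub>F u in at u. (s has_field_derivative c u * d u) (at u) \<and>
        (c has_field_derivative - (s u * d u)) (at u) \<and>
        (d has_field_derivative - (m\<^sup>2 * s u * c u)) (at u)"
      using R by (simp add: jacobi_sol_def eventually_cosparse_open_eq)
    show ?thesis
      by (intro conjI; rule eventually_nhds_x_imp_x; rule analytic_deriv_eq;
          (intro analytic_intros an)?; rule eventually_mono[OF ode]; simp)
  qed
  then show ?L
    using R by (simp add: is_jacobi_triple_def jacobi_sol_def)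
qed

text \<open>Justifies the definite description in \<open>jacobi_triple\<close>: normalising a global
  solution gives existence, and for normalised functions the uniqueness off a discrete set is
  equality.\<close>

lemma is_jacobi_triple_jacobi: "is_jacobi_triple m (jacobi_sn m, jacobi_cn m, jacobi_dn m)"
proof -
  have "\<exists>!t. is_jacobi_triple m t"
  proof (rule ex_ex1I)
    obtain s c d where sol: "jacobi_sol m UNIV s c d"
      using jacobi_sol_exists by blast
    then have "is_jacobi_triple m (remove_sings s, remove_sings c, remove_sings d)"
      unfolding is_jacobi_triple_iff
      by (auto simp: jacobi_sol_def[of m UNIV s c d]
          intro: jacobi_sol_remove_sings remove_sings_nicely_meromorphic)
    then show "\<exists>t. is_jacobi_triple m t" ..
  next
    fix t t' assume T: "is_jacobi_triple m t" "is_jacobi_triple m t'"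
    obtain s c d s' c' d' where t: "t = (s, c, d)" "t' = (s', c', d')"
      by (metis prod.exhaust)
    note sol = T[unfolded t is_jacobi_triple_iff]
    have "\<forall>\<^sub>\<approx>u\<in>UNIV. s u = s' u \<and> c u = c' u \<and> d u = d' u"
      using sol by (intro jacobi_sol_unique) auto
    then have ev: "\<forall>\<^sub>\<approx>u\<in>UNIV. s u = s' u" "\<forall>\<^sub>\<approx>u\<in>UNIV. c u = c' u" "\<forall>\<^sub>\<approx>u\<in>UNIV. d u = d' u"
      by (auto elim: eventually_mono)
    have "f = g" if "\<forall>\<^sub>\<approx>u\<in>UNIV. f u = g u" "f nicely_meromorphic_on UNIV" "g nicely_meromorphic_on UNIV" for f g
      using remove_sings_eq_of_cosparse_eq[OF that(1,3)] remove_sings_nicely_meromorphic_eq[OF that(2)] by simp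
    then show "t = t'"
      using ev sol by (simp add: t)
  qed
  then have "is_jacobi_triple m (jacobi_triple m)"
    unfolding jacobi_triple_def by (rule theI')
  then show ?thesis
    by (simp add: jacobi_sn_def jacobi_cn_def jacobi_dn_def)
qed

lemma jacobi_sol_jacobi: "jacobi_sol m UNIV (jacobi_sn m) (jacobi_cn m) (jacobi_dn m)"
  and jacobi_nicely_meromorphic:
    "jacobi_sn m nicely_meromorphic_on UNIV" "jacobi_cn m nicely_meromorphic_on UNIV"
    "jacobi_dn m nicely_meromorphic_on UNIV"
  using is_jacobi_triple_jacobi[of m] by (simp_all add: is_jacobi_triple_iff)

subsection \<open>Change of modulus\<close>

text \<open>The quotient rule and the two quadratic relations give the system of modulus
  \<open>l\<close> with an extra factor \<open>a\<close>, which the rescaling of the argument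
  removes. The conditions on \<open>a\<close> and \<open>l\<close> are squared because no particular
  choice of roots matters.\<close>

lemma jacobi_sol_quotients:
  assumes sol: "jacobi_sol m UNIV s c d" and a: "a\<^sup>2 = 1 - m\<^sup>2" "a \<noteq> 0" "(l * a)\<^sup>2 = - m\<^sup>2"
  shows "jacobi_sol l UNIV (\<lambda>u. a * s (inverse a * u) / d (inverse a * u))
     (\<lambda>u. c (inverse a * u) / d (inverse a * u)) (\<lambda>u. 1 / d (inverse a * u))"
proof -
  have mero: "s meromorphic_on UNIV" "c meromorphic_on UNIV" "d meromorphic_on UNIV"
    and an: "s analytic_on {0}" "c analytic_on {0}" "d analytic_on {0}"
    and init: "s 0 = 0" "c 0 = 1" "d 0 = 1"
    and ode: "\<forall>\<^sub>\<approx>u\<in>UNIV. (s has_field_derivative c u * d u) (at u) \<and>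
        (c has_field_derivative - (s u * d u)) (at u) \<and>
        (d has_field_derivative - (m\<^sup>2 * s u * c u)) (at u)"
    using sol by (auto simp: jacobi_sol_def)
  have "\<forall>\<^sub>\<approx>v\<in>UNIV. d v \<noteq> 0"
    using mero an init
    by (intro cosparse_neq_meromorphicI[of _ _ 0]) (auto intro: analytic_at_imp_isCont)
  moreover have "\<forall>\<^sub>\<approx>v\<in>UNIV. (c v)\<^sup>2 + (s v)\<^sup>2 = 1 \<and> (d v)\<^sup>2 + m\<^sup>2 * (s v)\<^sup>2 = 1"
    by (rule jacobi_sol_squares[OF sol]) auto
  ultimately have "\<forall>\<^sub>\<approx>v\<in>UNIV.
        ((\<lambda>v. a * s v / d v) has_field_derivative a * (c v / d v * (1 / d v))) (at v) \<and>
        ((\<lambda>v. c v / d v) has_field_derivative - (a * (a * s v / d v * (1 / d v)))) (at v) \<and>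
        ((\<lambda>v. 1 / d v) has_field_derivative - (a * (l\<^sup>2 * (a * s v / d v) * (c v / d v)))) (at v)"
    using ode
  proof eventually_elim
    case (elim v)
    then have sq: "(c v)\<^sup>2 + (s v)\<^sup>2 = 1" "(d v)\<^sup>2 + m\<^sup>2 * (s v)\<^sup>2 = 1" and dv: "d v \<noteq> 0"
      and ds: "(s has_field_derivative c v * d v) (at v)"
      and dc: "(c has_field_derivative - (s v * d v)) (at v)"
      and dd: "(d has_field_derivative - (m\<^sup>2 * s v * c v)) (at v)"
      by auto
    have "a * (c v * d v) * d v - a * s v * - (m\<^sup>2 * s v * c v) = a * c v * ((d v)\<^sup>2 + m\<^sup>2 * (s v)\<^sup>2)"
      by (simp add: algebra_simps power2_eq_square)
    then have 1: "((\<lambda>v. a * s v / d v) has_field_derivative a * c v / (d v * d v)) (at v)"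
      using DERIV_divide[OF DERIV_cmult[OF ds, of a] dd dv] sq by simp
    \<comment> \<open>The combination \<open>m\<^sup>2 * (c v)\<^sup>2 - (d v)\<^sup>2\<close> is
      the constant \<open>m\<^sup>2 - 1\<close>, which is where the first condition on
      \<open>a\<close> enters.\<close>
    have "- (s v * d v) * d v - c v * - (m\<^sup>2 * s v * c v) = s v * (m\<^sup>2 * (c v)\<^sup>2 - (d v)\<^sup>2)"
      by (simp add: algebra_simps power2_eq_square)
    also have "m\<^sup>2 * (c v)\<^sup>2 - (d v)\<^sup>2 = m\<^sup>2 * ((c v)\<^sup>2 + (s v)\<^sup>2) - ((d v)\<^sup>2 + m\<^sup>2 * (s v)\<^sup>2)"
      by (simp add: algebra_simps)
    also have "\<dots> = - (a * a)"
      unfolding sq using a(1) by (simp add: power2_eq_square)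
    finally have 2: "((\<lambda>v. c v / d v) has_field_derivative s v * - (a * a) / (d v * d v)) (at v)"
      using DERIV_divide[OF dc dd dv] by simp
    have 3: "((\<lambda>v. 1 / d v) has_field_derivative m\<^sup>2 * s v * c v / (d v * d v)) (at v)"
      using DERIV_divide[OF DERIV_const[of 1] dd dv] by simp
    \<comment> \<open>Rewrites the derivative of \<open>1 / d v\<close> with the coefficient
      \<open>l\<^sup>2\<close> of the new modulus.\<close>
    have "m\<^sup>2 = - (a * l\<^sup>2 * a)"
      using a(3) by (simp add: power_mult_distrib power2_eq_square mult_ac)
    with 1 2 3 show ?case
      by (simp add: mult_ac)
  qed
  then show ?thesis
    \<comment> \<open>The rotation moves the differential equations, which follow nine premises on
      meromorphy, analyticity and initial values, to the front.\<close>
    by (rule jacobi_sol_scaleI[rotated 9])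
      (use init a(2) in \<open>auto intro!: meromorphic_intros analytic_intros mero an\<close>)
qed

text \<open>Returns from the variable \<open>u = a * z\<close> to \<open>z\<close> and upgrades
  agreement off a discrete set to equality at every point, poles included.\<close>

lemma nicely_meromorphic_eq_remove_sings_scaled:
  assumes "g nicely_meromorphic_on UNIV" "a \<noteq> 0" "\<forall>\<^sub>\<approx>u\<in>UNIV. g u = f (inverse a * u)"
  shows "remove_sings f z = g (a * z)"
proof -
  have "\<forall>\<^sub>\<approx>z\<in>UNIV. g (a * z) = f (inverse a * (a * z))"
    by (rule cosparse_scale[OF assms(3)]) (use assms(2) in auto)
  then have "\<forall>\<^sub>\<approx>z\<in>UNIV. f z = g (a * z)"
    by eventually_elim (use assms(2) in \<open>simp flip: mult.assoc\<close>)
  then have "remove_sings f z = remove_sings (\<lambda>z. g (a * z)) z"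
    by (intro remove_sings_cong) (simp_all add: eventually_cosparse_open_eq)
  also have "\<dots> = g (a * z)"
    by (simp add: remove_sings_scale assms(2) remove_sings_nicely_meromorphic_eq[OF assms(1)])
  finally show ?thesis .
qed

text \<open>The rescaled quotients of modulus \<open>m\<close> and the Jacobi functions of modulus
  \<open>l\<close> solve the same system with the same initial values, so uniqueness identifies
  them.\<close>

lemma jacobi_quotient_transformation:
  assumes a: "a\<^sup>2 = 1 - m\<^sup>2" "a \<noteq> 0" "(l * a)\<^sup>2 = - m\<^sup>2"
  shows "jacobi_sd m z = 1 / a * jacobi_sn l (a * z)"
    and "jacobi_cd m z = jacobi_cn l (a * z)"
    and "jacobi_nd m z = jacobi_dn l (a * z)"
proof -
  have ev: "\<forall>\<^sub>\<approx>u\<in>UNIV.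
      jacobi_sn l u = a * jacobi_sn m (inverse a * u) / jacobi_dn m (inverse a * u) \<and>
      jacobi_cn l u = jacobi_cn m (inverse a * u) / jacobi_dn m (inverse a * u) \<and>
      jacobi_dn l u = 1 / jacobi_dn m (inverse a * u)"
    using jacobi_sol_unique[OF jacobi_sol_jacobi jacobi_sol_quotients[OF jacobi_sol_jacobi a]
        open_UNIV connected_UNIV UNIV_I] .
  have "\<forall>\<^sub>\<approx>u\<in>UNIV. 1 / a * jacobi_sn l u = jacobi_sn m (inverse a * u) / jacobi_dn m (inverse a * u)"
    using ev by eventually_elim (use a(2) in simp)
  from nicely_meromorphic_eq_remove_sings_scaled[OF nicely_meromorphic_on_cmult_left[OF jacobi_nicely_meromorphic(1)] a(2) this]
  show "jacobi_sd m z = 1 / a * jacobi_sn l (a * z)"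
    by (simp add: jacobi_sd_def)
  have "\<forall>\<^sub>\<approx>u\<in>UNIV. jacobi_cn l u = jacobi_cn m (inverse a * u) / jacobi_dn m (inverse a * u)"
    using ev by eventually_elim simp
  from nicely_meromorphic_eq_remove_sings_scaled[OF jacobi_nicely_meromorphic(2) a(2) this]
  show "jacobi_cd m z = jacobi_cn l (a * z)"
    by (simp add: jacobi_cd_def)
  have "\<forall>\<^sub>\<approx>u\<in>UNIV. jacobi_dn l u = 1 / jacobi_dn m (inverse a * u)"
    using ev by eventually_elim simp
  from nicely_meromorphic_eq_remove_sings_scaled[OF jacobi_nicely_meromorphic(3) a(2) this]
  show "jacobi_nd m z = jacobi_dn l (a * z)"
    by (simp add: jacobi_nd_def)
qed

subsection \<open>Lie brackets\<close>

text \<open>Reduces a bracket to a computation off a discrete set, with the constant coefficients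
  pulled out by bilinearity.\<close>

lemma lie_bracket_eqI:
  assumes "h nicely_meromorphic_on UNIV"
    and "\<forall>\<^sub>\<approx>u\<in>UNIV. (f has_field_derivative f' u) (at u) \<and> (g has_field_derivative g' u) (at u) \<and>
      a * b * (f u * g' u - g u * f' u) = h u"
  shows "lie_bracket (\<lambda>u. a * f u) (\<lambda>u. b * g u) = h"
  unfolding lie_bracket_def
proof (rule remove_sings_eq_of_cosparse_eq[OF _ assms(1)])
  from assms(2) show "\<forall>\<^sub>\<approx>u\<in>UNIV. a * f u * deriv (\<lambda>u. b * g u) u - b * g u * deriv (\<lambda>u. a * f u) u = h u"
  proof eventually_elim
    case (elim u)
    then have "deriv (\<lambda>u. a * f u) u = a * f' u" "deriv (\<lambda>u. b * g u) u = b * g' u"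
      by (auto intro!: DERIV_imp_deriv DERIV_cmult)
    with elim show ?case
      by (simp add: algebra_simps)
  qed
qed

text \<open>Each bracket of two of the functions is the third one times a combination of squares,
  and the quadratic relations make that combination constant.\<close>

lemma lie_bracket_jacobi:
  shows "lie_bracket (\<lambda>u. a * jacobi_dn m u) (\<lambda>u. b * jacobi_cn m u) =
      (\<lambda>u. - (a * b * (1 - m\<^sup>2)) * jacobi_sn m u)" (is ?dc)
    and "lie_bracket (\<lambda>u. a * jacobi_dn m u) (\<lambda>u. b * jacobi_sn m u) = (\<lambda>u. a * b * jacobi_cn m u)" (is ?ds)
    and "lie_bracket (\<lambda>u. a * jacobi_cn m u) (\<lambda>u. b * jacobi_sn m u) = (\<lambda>u. a * b * jacobi_dn m u)" (is ?cs)
proof -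
  let ?s = "jacobi_sn m" and ?c = "jacobi_cn m" and ?d = "jacobi_dn m"
  have "\<forall>\<^sub>\<approx>u\<in>UNIV. (?s has_field_derivative ?c u * ?d u) (at u) \<and>
        (?c has_field_derivative - (?s u * ?d u)) (at u) \<and>
        (?d has_field_derivative - (m\<^sup>2 * ?s u * ?c u)) (at u)"
    using jacobi_sol_jacobi by (simp add: jacobi_sol_def)
  moreover have "\<forall>\<^sub>\<approx>u\<in>UNIV. (?c u)\<^sup>2 + (?s u)\<^sup>2 = 1 \<and> (?d u)\<^sup>2 + m\<^sup>2 * (?s u)\<^sup>2 = 1"
    by (rule jacobi_sol_squares[OF jacobi_sol_jacobi]) auto
  ultimately have ev: "\<forall>\<^sub>\<approx>u\<in>UNIV. ((?s has_field_derivative ?c u * ?d u) (at u) \<and>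
        (?c has_field_derivative - (?s u * ?d u)) (at u) \<and>
        (?d has_field_derivative - (m\<^sup>2 * ?s u * ?c u)) (at u)) \<and>
        (?c u)\<^sup>2 + (?s u)\<^sup>2 = 1 \<and> (?d u)\<^sup>2 + m\<^sup>2 * (?s u)\<^sup>2 = 1"
    by (rule eventually_conj)
  note mero = nicely_meromorphic_on_cmult_left[OF jacobi_nicely_meromorphic(1)]
    nicely_meromorphic_on_cmult_left[OF jacobi_nicely_meromorphic(2)]
    nicely_meromorphic_on_cmult_left[OF jacobi_nicely_meromorphic(3)]
  show ?dc
  proof (rule lie_bracket_eqI[OF mero(1)])
    from ev show "\<forall>\<^sub>\<approx>u\<in>UNIV. (?d has_field_derivative - (m\<^sup>2 * ?s u * ?c u)) (at u) \<and>
        (?c has_field_derivative - (?s u * ?d u)) (at u) \<and>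
        a * b * (?d u * - (?s u * ?d u) - ?c u * - (m\<^sup>2 * ?s u * ?c u)) = - (a * b * (1 - m\<^sup>2)) * ?s u"
    proof eventually_elim
      case (elim u)
      have "?d u * - (?s u * ?d u) - ?c u * - (m\<^sup>2 * ?s u * ?c u) =
          ?s u * (m\<^sup>2 * ((?c u)\<^sup>2 + (?s u)\<^sup>2) - ((?d u)\<^sup>2 + m\<^sup>2 * (?s u)\<^sup>2))"
        by (simp add: algebra_simps power2_eq_square)
      also have "\<dots> = - ((1 - m\<^sup>2) * ?s u)"
        using elim by (simp add: left_diff_distrib right_diff_distrib mult.commute)
      finally show ?case
        using elim by simp
    qed
  qed
  show ?ds
  proof (rule lie_bracket_eqI[OF mero(2)])
    from ev show "\<forall>\<^sub>\<approx>u\<in>UNIV. (?d has_field_derivative - (m\<^sup>2 * ?s u * ?c u)) (at u) \<and>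
        (?s has_field_derivative ?c u * ?d u) (at u) \<and>
        a * b * (?d u * (?c u * ?d u) - ?s u * - (m\<^sup>2 * ?s u * ?c u)) = a * b * ?c u"
    proof eventually_elim
      case (elim u)
      have "?d u * (?c u * ?d u) - ?s u * - (m\<^sup>2 * ?s u * ?c u) = ?c u * ((?d u)\<^sup>2 + m\<^sup>2 * (?s u)\<^sup>2)"
        by (simp add: algebra_simps power2_eq_square)
      then show ?case
        using elim by simp
    qed
  qed
  show ?cs
  proof (rule lie_bracket_eqI[OF mero(3)])
    from ev show "\<forall>\<^sub>\<approx>u\<in>UNIV. (?c has_field_derivative - (?s u * ?d u)) (at u) \<and>
        (?s has_field_derivative ?c u * ?d u) (at u) \<and>
        a * b * (?c u * (?c u * ?d u) - ?s u * - (?s u * ?d u)) = a * b * ?d u"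
    proof eventually_elim
      case (elim u)
      have "?c u * (?c u * ?d u) - ?s u * - (?s u * ?d u) = ?d u * ((?c u)\<^sup>2 + (?s u)\<^sup>2)"
        by (simp add: algebra_simps power2_eq_square)
      then show ?case
        using elim by simp
    qed
  qed
qed

text \<open>Antisymmetry is immediate before normalisation, and negation preserves normalised
  functions.\<close>

lemma lie_bracket_swap:
  assumes "f meromorphic_on UNIV" "g meromorphic_on UNIV"
  shows "lie_bracket g f = (\<lambda>u. - lie_bracket f g u)"
proof -
  let ?h = "\<lambda>u. f u * deriv g u - g u * deriv f u"
  have mero: "?h meromorphic_on UNIV"
    by (intro meromorphic_intros assms)
  have "\<forall>\<^sub>\<approx>u\<in>UNIV. g u * deriv f u - f u * deriv g u = - remove_sings ?h u"
    using eventually_remove_sings_eq[OF mero] by eventually_elim simp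
  then show ?thesis
    unfolding lie_bracket_def
    by (rule remove_sings_eq_of_cosparse_eq)
      (intro nicely_meromorphic_on_uminus remove_sings_nicely_meromorphic mero)
qed

theorem mainTheorem6:
  fixes k k' :: real and lam :: complex
  assumes "0 < k" and "k < 1"
    and "k' = sqrt (1 - k\<^sup>2)"
    and "lam = \<i> * of_real k / of_real k'"
  shows "cmod lam = k / sqrt (1 - k\<^sup>2) \<and> 0 < cmod lam
    \<and> (\<forall>z. jacobi_sd (of_real k) z = 1 / of_real k' * jacobi_sn lam (of_real k' * z))
    \<and> (\<forall>z. jacobi_cd (of_real k) z = jacobi_cn lam (of_real k' * z))
    \<and> (\<forall>z. jacobi_nd (of_real k) z = jacobi_dn lam (of_real k' * z))
    \<and> elliptic_CK
        (\<lambda>u. - of_real k' * jacobi_dn lam u)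
        (\<lambda>u. \<i> * of_real k' * jacobi_cn lam u)
        (\<lambda>u. \<i> * jacobi_sn lam u)
    \<and> hyperbolic_CK
        (\<lambda>u. of_real k' * jacobi_dn lam u)
        (\<lambda>u. jacobi_sn lam u)
        (\<lambda>u. of_real k' * jacobi_cn lam u)
    \<and> co_hyperbolic_CK
        (\<lambda>u. \<i> * of_real k' * jacobi_dn lam u)
        (\<lambda>u. \<i> * jacobi_sn lam u)
        (\<lambda>u. - of_real k' * jacobi_cn lam u)
    \<and> doubly_hyperbolic_CK
        (\<lambda>u. jacobi_sn lam u)
        (\<lambda>u. of_real k' * jacobi_cn lam u)
        (\<lambda>u. - of_real k' * jacobi_dn lam u)"
proof -
  define a :: complex where "a = of_real k'"
  have k2: "k\<^sup>2 < 1"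
    using assms(1,2) by (simp add: power_less_one_iff)
  then have k'_pos: "k' > 0"
    using assms(3) by simp
  then have a_nz: "a \<noteq> 0"
    by (simp add: a_def)
  have "k'\<^sup>2 = 1 - k\<^sup>2"
    using k2 assms(3) by simp
  then have a2: "a\<^sup>2 = 1 - (of_real k)\<^sup>2"
    unfolding a_def by (metis of_real_1 of_real_diff of_real_power)
  have lam_a: "(lam * a)\<^sup>2 = - (of_real k)\<^sup>2"
    using a_nz by (simp add: assms(4) flip: a_def) (simp add: power_mult_distrib)
  \<comment> \<open>In every realization the dn and cn fields both carry a factor \<open>k'\<close>.
    This identity cancels the resulting \<open>k'\<^sup>2\<close>, so that their bracket is sn with
    a coefficient free of \<open>k'\<close>.\<close>
  have "(1 - lam\<^sup>2) * (a * a) = a\<^sup>2 - (lam * a)\<^sup>2"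
    by (simp add: algebra_simps power2_eq_square)
  also have "\<dots> = 1"
    by (simp add: a2 lam_a)
  finally have one_minus: "1 - lam\<^sup>2 = 1 / (a * a)"
    using a_nz by (simp add: eq_divide_eq)
  have norm_lam: "cmod lam = k / sqrt (1 - k\<^sup>2)"
    using assms k'_pos by (simp add: norm_mult norm_divide)
  note trans = jacobi_quotient_transformation[OF a2 a_nz lam_a]
  note nice = jacobi_nicely_meromorphic[of lam]
  have mero: "(\<lambda>u. c * f u) meromorphic_on UNIV" if "f nicely_meromorphic_on UNIV" for c f
    using that by (auto intro: meromorphic_intros simp: nicely_meromorphic_on_def)
  note br = lie_bracket_jacobi[where m = lam]
  \<comment> \<open>The realizations also require the brackets in the opposite order, for instance
    when \<open>J\<close> is sn.\<close>
  have br_rev: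
    "lie_bracket (\<lambda>u. p * jacobi_cn lam u) (\<lambda>u. q * jacobi_dn lam u) = (\<lambda>u. p * q * (1 - lam\<^sup>2) * jacobi_sn lam u)"
    "lie_bracket (\<lambda>u. p * jacobi_sn lam u) (\<lambda>u. q * jacobi_dn lam u) = (\<lambda>u. - (p * q) * jacobi_cn lam u)"
    "lie_bracket (\<lambda>u. p * jacobi_sn lam u) (\<lambda>u. q * jacobi_cn lam u) = (\<lambda>u. - (p * q) * jacobi_dn lam u)" for p q
    by (subst lie_bracket_swap[OF mero[OF nice(3)] mero[OF nice(2)]]
              lie_bracket_swap[OF mero[OF nice(3)] mero[OF nice(1)]]
              lie_bracket_swap[OF mero[OF nice(2)] mero[OF nice(1)]], simp add: br mult_ac)+
  \<comment> \<open>A bare \<open>jacobi_sn lam\<close> does not match the pattern with a constant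
    coefficient, so the case of coefficient 1 is stated separately for rewriting.\<close>
  have br1: "lie_bracket (\<lambda>u. p * jacobi_dn lam u) (jacobi_sn lam) = (\<lambda>u. p * jacobi_cn lam u)"
    "lie_bracket (jacobi_sn lam) (\<lambda>u. p * jacobi_dn lam u) = (\<lambda>u. - p * jacobi_cn lam u)"
    "lie_bracket (jacobi_sn lam) (\<lambda>u. p * jacobi_cn lam u) = (\<lambda>u. - p * jacobi_dn lam u)" for p
    using br(2)[of p 1] br_rev(2,3)[of 1 p] by simp_all
  have fields: "meromorphic_vector_field (jacobi_sn lam)" "meromorphic_vector_field (\<lambda>u. p * jacobi_sn lam u)"
    "meromorphic_vector_field (\<lambda>u. p * jacobi_cn lam u)" "meromorphic_vector_field (\<lambda>u. p * jacobi_dn lam u)" for p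
    unfolding meromorphic_vector_field_def by (intro nicely_meromorphic_on_cmult_left nice)+
  show ?thesis
    unfolding elliptic_CK_def hyperbolic_CK_def co_hyperbolic_CK_def doubly_hyperbolic_CK_def
    unfolding a_def[symmetric] br br_rev br1 one_minus
    by (intro conjI allI norm_lam trans fields) (use norm_lam assms(1) k2 a_nz in \<open>simp_all add: mult.assoc mult.left_commute[of a \<i>] mult.commute[of a \<i>]\<close>)
qed

end
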